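(* Let $F=f+g$ on $\mathbb{R}^d$, where $f$ is convex and $L$-smooth and $g$ is proper, lower semicontinuous and convex, and let $F_*=\min F$. Suppose $F(x_0)-F_*\le\epsilon_0$ and that $F$ satisfies the HEB condition on $\mathcal{S}_{\epsilon_0}$ with parameters $\theta\in(0,1]$ and $0<c<\infty$. Let $0<\epsilon\le\epsilon_0$ and $\epsilon_k=\epsilon_0/2^k$. Running the restarting accelerated proximal gradient method rAPG from $x_0$ with $K=\lceil\log_2\frac{\epsilon_0}{\epsilon}\rceil$ stages and $t_k=\lceil 2c\sqrt{L}\,\epsilon_{k-1}^{\theta-1/2}\rceil$ inner iterations at stage $k$, one has $F(x_K)-F_*\le\epsilon$. The iteration complexity of rAPG (total number $\sum_{k=1}^K t_k$ of inner iterations) is $$O\!\left(c\sqrt{L}\,\epsilon_0^{\theta-1/2}\right)\ \text{ if }\theta>1/2,\qquad O\!\left(\max\left\{\frac{c\sqrt{L}}{\epsilon^{1/2-\theta}},\ c\sqrt{L}\log\left(\frac{\epsilon_0}{\epsilon}\right)\right\}\right)\ \text{ if }\theta\le1/2.$$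
   Context: A function $f$ is $L$-smooth ($L>0$) if it is differentiable with $\|\nabla f(x)-\nabla f(y)\|_2\le L\|x-y\|_2$ for all $x,y$. The set of minimizers of $F$ is $\Omega_*$ (assumed nonempty), $F_*$ is the minimum value, $D(x,\Omega_* )=\min_{y\in\Omega_*}\|x-y\|_2$, and $\mathcal{S}_\xi=\{x\in\mathbb{R}^d: F(x)-F_*\le\xi\}$. HEB condition on $\mathcal{S}_\xi$ with parameters $\theta\in(0,1]$, $0<c<\infty$: $D(x,\Omega_* )\le c\,(F(x)-F_* )^\theta$ for all $x\in\mathcal{S}_\xi$. Proximal mapping: $P_{\eta g}(u)=\arg\min_{x}\frac12\|x-u\|_2^2+\eta g(x)$. rAPG: given $x_0$, for $k=1,\dots,K$: set $y^k_1=x^k_1=x_{k-1}$; for $\tau=1,\dots,t_k$ set $x^k_{\tau+1}=P_{g/L}(y^k_\tau-\nabla f(y^k_\tau)/L)$ and $y^k_{\tau+1}=x^k_{\tau+1}+\frac{\tau}{\tau+3}(x^k_{\tau+1}-x^k_\tau)$; then set $x_k=x^k_{t_k+1}$. The output is $x_K$. $O(\cdot)$ hides a constant that may depend on $\theta$ but not on $c,L,\epsilon_0,\epsilon$ or the problem instance.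
   Formalization: As stated the O-bounds fail, since rounding up makes every t_k at least 1; proved instead: the total is at most C(θ) times the stated rate plus K in all cases, and at most C(θ) times the rate when every 2c√L ε_{k-1}^{θ-1/2} is at least 1. *)

theory Defs
  imports "HOL-Analysis.Analysis"
begin

definition gradient :: "('a::real_inner \<Rightarrow> real) \<Rightarrow> 'a \<Rightarrow> 'a" where
  "gradient f x = (THE D. GDERIV f x :> D)"

definition smooth_with :: "real \<Rightarrow> ('a::real_inner \<Rightarrow> real) \<Rightarrow> bool" where
  "smooth_with L f \<longleftrightarrow> 0 < L \<and> (\<forall>x. f differentiable (at x)) \<and>
     (\<forall>x y. norm (gradient f x - gradient f y) \<le> L * norm (x - y))"

definition proper_fun :: "('a \<Rightarrow> ereal) \<Rightarrow> bool" where
  "proper_fun g \<longleftrightarrow> (\<forall>x. g x \<noteq> -\<infinity>) \<and> (\<exists>x. g x \<noteq> \<infinity>)"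

definition lower_semicontinuous :: "('a::topological_space \<Rightarrow> ereal) \<Rightarrow> bool" where
  "lower_semicontinuous g \<longleftrightarrow> (\<forall>x. g x \<le> Liminf (nhds x) g)"

(* Jensen's inequality; meaningful for functions that avoid -\<infinity>, with 0 * \<infinity> = 0 as in ereal. *)
definition convex_ereal :: "('a::real_vector \<Rightarrow> ereal) \<Rightarrow> bool" where
  "convex_ereal g \<longleftrightarrow> (\<forall>x y. \<forall>u\<ge>0. \<forall>v\<ge>0. u + v = 1 \<longrightarrow>
     g (u *\<^sub>R x + v *\<^sub>R y) \<le> ereal u * g x + ereal v * g y)"

definition objective :: "('a \<Rightarrow> real) \<Rightarrow> ('a \<Rightarrow> ereal) \<Rightarrow> 'a \<Rightarrow> ereal" where
  "objective f g x = ereal (f x) + g x"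

definition minimizers :: "('a \<Rightarrow> ereal) \<Rightarrow> 'a set" where
  "minimizers F = {x. \<forall>y. F x \<le> F y}"

(* The minimum value whenever minimizers F is nonempty. *)
definition min_value :: "('a \<Rightarrow> ereal) \<Rightarrow> ereal" where
  "min_value F = (INF x. F x)"

definition sublevel_gap :: "('a \<Rightarrow> ereal) \<Rightarrow> real \<Rightarrow> 'a set" where
  "sublevel_gap F \<xi> = {x. F x - min_value F \<le> ereal \<xi>}"

(* The gap is finite on sublevel_gap F \<xi> when F is proper and attains its minimum,
   so real_of_ereal loses nothing there; infdist is then the attained distance to the
   (closed) set of minimizers if F is also lower semicontinuous. *)
definition heb_on_sublevel ::
  "('a::metric_space \<Rightarrow> ereal) \<Rightarrow> real \<Rightarrow> real \<Rightarrow> real \<Rightarrow> bool" where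
  "heb_on_sublevel F \<xi> \<theta> c \<longleftrightarrow> (\<forall>x\<in>sublevel_gap F \<xi>.
     infdist x (minimizers F) \<le> c * real_of_ereal (F x - min_value F) powr \<theta>)"

definition prox :: "real \<Rightarrow> ('a::real_normed_vector \<Rightarrow> ereal) \<Rightarrow> 'a \<Rightarrow> 'a" where
  "prox \<eta> g u = (ARG_MIN (\<lambda>x. ereal ((norm (x - u))\<^sup>2 / 2) + ereal \<eta> * g x) x. True)"

(* apg_state L f g z n is the pair (x, y) with index n + 1, i.e. after n inner iterations
   started at z; the step from n to Suc n is inner iteration number \<tau> = Suc n. *)
primrec apg_state ::
  "real \<Rightarrow> ('a::real_inner \<Rightarrow> real) \<Rightarrow> ('a \<Rightarrow> ereal) \<Rightarrow> 'a \<Rightarrow> nat \<Rightarrow> 'a \<times> 'a" where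
  "apg_state L f g z 0 = (z, z)"
| "apg_state L f g z (Suc n) =
     (let (x, y) = apg_state L f g z n;
          \<tau> = real (Suc n);
          x' = prox (1 / L) g (y - (1 / L) *\<^sub>R gradient f y)
      in (x', x' + (\<tau> / (\<tau> + 3)) *\<^sub>R (x' - x)))"

(* rapg L f g t x0 k is the output of stage k, with t k inner iterations in stage k. *)
primrec rapg ::
  "real \<Rightarrow> ('a::real_inner \<Rightarrow> real) \<Rightarrow> ('a \<Rightarrow> ereal) \<Rightarrow> (nat \<Rightarrow> nat) \<Rightarrow> 'a \<Rightarrow> nat \<Rightarrow> 'a" where
  "rapg L f g t x0 0 = x0"
| "rapg L f g t x0 (Suc k) = fst (apg_state L f g (rapg L f g t x0 k) (t (Suc k)))"

definition target_gap :: "real \<Rightarrow> nat \<Rightarrow> real" where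
  "target_gap \<epsilon>0 k = \<epsilon>0 / 2 ^ k"

definition num_stages :: "real \<Rightarrow> real \<Rightarrow> nat" where
  "num_stages \<epsilon>0 \<epsilon> = nat \<lceil>log 2 (\<epsilon>0 / \<epsilon>)\<rceil>"

definition unrounded_iters :: "real \<Rightarrow> real \<Rightarrow> real \<Rightarrow> real \<Rightarrow> nat \<Rightarrow> real" where
  "unrounded_iters \<theta> c L \<epsilon>0 k = 2 * c * sqrt L * target_gap \<epsilon>0 (k - 1) powr (\<theta> - 1/2)"

definition inner_iters :: "real \<Rightarrow> real \<Rightarrow> real \<Rightarrow> real \<Rightarrow> nat \<Rightarrow> nat" where
  "inner_iters \<theta> c L \<epsilon>0 k = nat \<lceil>unrounded_iters \<theta> c L \<epsilon>0 k\<rceil>"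

definition total_iters :: "real \<Rightarrow> real \<Rightarrow> real \<Rightarrow> real \<Rightarrow> real \<Rightarrow> nat" where
  "total_iters \<theta> c L \<epsilon>0 \<epsilon> = (\<Sum>k = 1..num_stages \<epsilon>0 \<epsilon>. inner_iters \<theta> c L \<epsilon>0 k)"

(* Rounding up makes total_iters at least num_stages, whereas rapg_rate tends to 0 with
   c * sqrt L and, for \<theta> > 1/2, does not grow as \<epsilon> tends to 0.  So no multiple of rapg_rate
   alone bounds total_iters for all parameters: either every unrounded count must be bounded
   below (say by 1), or the rounding error of at most one iteration per stage must be added. *)
definition rapg_rate :: "real \<Rightarrow> real \<Rightarrow> real \<Rightarrow> real \<Rightarrow> real \<Rightarrow> real" where
  "rapg_rate \<theta> c L \<epsilon>0 \<epsilon> =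
     (if \<theta> > 1/2 then c * sqrt L * \<epsilon>0 powr (\<theta> - 1/2)
      else max (c * sqrt L / \<epsilon> powr (1/2 - \<theta>)) (c * sqrt L * ln (\<epsilon>0 / \<epsilon>)))"

end

theory Submission
  imports Defs
begin

text \<open>
  Each stage of the restarted method halves the upper bound on the excess \<open>F x - F\<^sub>*\<close>, so that
  \<open>\<lceil>log 2 (\<epsilon>0 / \<epsilon>)\<rceil>\<close> stages bring it from \<open>\<epsilon>0\<close> to \<open>\<epsilon>\<close>.

  Inside a stage this is the accelerated \<open>1 / t\<^sup>2\<close> rate. A proximal gradient step satisfies
  \<open>F p + L/2 * \<parallel>p - w\<parallel>\<^sup>2 \<le> F w + L/2 * \<parallel>y - w\<parallel>\<^sup>2\<close> for every \<open>w\<close> (\<open>gap_prox_grad\<close>). Taking for \<open>w\<close> a suitable point between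
  the current iterate and a minimizer turns this into the decrease of an energy, a weighted excess plus a squared
  distance (\<open>apg_energy\<close>). The momentum \<open>\<tau> / (\<tau> + 3)\<close> matches the weights \<open>(\<tau> + 2) / 2\<close>. These start at \<open>3/2\<close> rather than
  at \<open>1\<close>, so the initial excess stays in the bound besides the initial distance \<open>D\<close> to the minimizers:
  after \<open>t\<close> iterations from \<open>z\<close> the excess is at most
  \<open>(4 * (F z - F\<^sub>*) + 2 * L * D\<^sup>2) / (t + 2)\<^sup>2\<close> (\<open>apg_gap\<close>). The error bound condition gives \<open>D \<le> c * e powr \<theta>\<close> when the excess
  at the start of the stage is at most \<open>e\<close>, and the prescribed \<open>t\<close> is large enough for the quotient to be
  at most \<open>e / 2\<close> (\<open>apg_halves_gap\<close>).

  The proximal points have to exist for any of this. At a minimizer of \<open>F = f + g\<close> the negative gradient of \<open>f\<close> is a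
  subgradient of \<open>g\<close>, hence \<open>g\<close> has an affine minorant, the proximal objective is coercive, and semicontinuity yields a
  minimizer (\<open>minimizer_subgradient\<close>, \<open>minimizers_quadratic_nonempty\<close>).

  The unrounded stage lengths form a geometric progression with ratio \<open>2 powr (1/2 - \<theta>)\<close>, whose sum is governed by its first
  term, its last term or the number of terms according to the sign of \<open>\<theta> - 1/2\<close> (\<open>sum_unrounded_iters_le_rate\<close>). Rounding up adds at
  most one iteration per stage, or at most doubles a stage whose unrounded length is at least \<open>1\<close>.
\<close>

section \<open>Gradients of smooth and convex functions\<close>

lemma GDERIV_gradient:
  fixes f :: "'a::euclidean_space \<Rightarrow> real"
  assumes "f differentiable (at x)"
  shows "GDERIV f x :> gradient f x"
proof -
  obtain f' where f': "(f has_derivative f') (at x)"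
    using assms by (auto simp: differentiable_def)
  interpret linear f'
    using f' by (rule has_derivative_linear)
  define D where "D = (\<Sum>b\<in>Basis. f' b *\<^sub>R b)"
  have "f' h = h \<bullet> D" for h
  proof -
    have "f' h = f' (\<Sum>b\<in>Basis. (h \<bullet> b) *\<^sub>R b)"
      by (simp add: euclidean_representation)
    also have "\<dots> = h \<bullet> D"
      unfolding D_def by (simp add: sum scaleR inner_sum_right mult.commute)
    finally show ?thesis .
  qed
  then have D: "GDERIV f x :> D"
    using f' by (simp add: gderiv_def ext[of f' "\<lambda>h. h \<bullet> D"])
  have "E = D" if "GDERIV f x :> E" for E
  proof -
    have "(\<lambda>h. h \<bullet> E) = (\<lambda>h. h \<bullet> D)"
      using that D unfolding gderiv_def by (rule has_derivative_unique)
    then show ?thesis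
      by (metis vector_eq_ldot)
  qed
  with D show ?thesis
    unfolding gradient_def by (rule theI)
qed

text \<open>
  Both analytic inequalities for smooth and convex functions reduce to one real variable by
  restricting the function to a line.
\<close>
lemma DERIV_along_line:
  assumes "GDERIV f (x + t *\<^sub>R d) :> D"
  shows "((\<lambda>t. f (x + t *\<^sub>R d)) has_real_derivative D \<bullet> d) (at t)"
proof -
  have "((\<lambda>t. f (x + t *\<^sub>R d)) has_derivative (\<lambda>h. (h *\<^sub>R d) \<bullet> D)) (at t)"
    using assms unfolding gderiv_def
    by (rule has_derivative_compose[rotated]) (auto intro!: derivative_eq_intros)
  then show ?thesis
    by (simp add: has_field_derivative_def inner_commute mult.commute[of _ "D \<bullet> d"])
qed

text \<open>
  Dividing by \<open>t\<close> and letting \<open>t\<close> decrease to \<open>0\<close> turns a lower bound on all short increments into one on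
  the directional derivative. This single limit gives both the tangent inequality of a convex function
  (applied to \<open>- f\<close>) and the first-order optimality condition below.
\<close>
lemma inner_gradient_ge_of_secants:
  assumes "GDERIV \<phi> x :> D"
    and secant: "\<And>t. 0 < t \<Longrightarrow> t < 1 \<Longrightarrow> t * a \<le> \<phi> (x + t *\<^sub>R d) - \<phi> x"
  shows "a \<le> D \<bullet> d"
proof -
  have "((\<lambda>t. \<phi> (x + t *\<^sub>R d)) has_real_derivative D \<bullet> d) (at 0)"
    by (rule DERIV_along_line) (simp add: assms(1))
  then have "((\<lambda>t. (\<phi> (x + t *\<^sub>R d) - \<phi> x) / t) \<longlongrightarrow> D \<bullet> d) (at_right 0)"
    by (auto simp: has_field_derivative_iff intro: tendsto_mono[OF at_le])
  moreover have "\<forall>\<^sub>F t in at_right 0. a \<le> (\<phi> (x + t *\<^sub>R d) - \<phi> x) / t"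
    using eventually_at_right_real[OF zero_less_one]
  proof eventually_elim
    case (elim t)
    then show ?case using secant[of t] by (simp add: field_simps)
  qed
  ultimately show ?thesis
    by (rule tendsto_lowerbound) simp
qed

lemma convex_on_above_tangent:
  assumes "convex_on UNIV f" "GDERIV f y :> D"
  shows "f y + D \<bullet> (z - y) \<le> f z"
proof -
  have "f y - f z \<le> (- D) \<bullet> (z - y)"
  proof (rule inner_gradient_ge_of_secants[OF GDERIV_minus[OF assms(2)]])
    fix t :: real assume t: "0 < t" "t < 1"
    have "f (y + t *\<^sub>R (z - y)) = f ((1 - t) *\<^sub>R y + t *\<^sub>R z)"
      by (simp add: algebra_simps)
    also have "\<dots> \<le> (1 - t) * f y + t * f z"
      using convex_onD[OF assms(1), of t y z] t by simp
    finally show "t * (f y - f z) \<le> - f (y + t *\<^sub>R (z - y)) - - f y"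
      by (simp add: algebra_simps)
  qed
  then show ?thesis by simp
qed

text \<open>
  The function minus its quadratic model, restricted to the segment from \<open>y\<close> to \<open>z\<close>, is nonincreasing:
  by Cauchy--Schwarz and the Lipschitz gradient its derivative at \<open>t\<close> is at most \<open>0\<close>.
\<close>
lemma smooth_descent:
  fixes f :: "'a::euclidean_space \<Rightarrow> real"
  assumes "smooth_with L f"
  shows "f z \<le> f y + gradient f y \<bullet> (z - y) + L / 2 * (norm (z - y))\<^sup>2"
proof -
  define d where "d = z - y"
  define \<psi> where "\<psi> t = f (y + t *\<^sub>R d) - t * (gradient f y \<bullet> d) - L / 2 * (norm d)\<^sup>2 * t\<^sup>2" for t
  have "\<psi> 1 \<le> \<psi> 0"
  proof (rule DERIV_nonpos_imp_nonincreasing[of 0 1 \<psi>])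
    fix t :: real assume t: "0 \<le> t" "t \<le> 1"
    have "GDERIV f (y + t *\<^sub>R d) :> gradient f (y + t *\<^sub>R d)"
      using assms by (intro GDERIV_gradient) (simp add: smooth_with_def)
    then have "(\<psi> has_real_derivative
        gradient f (y + t *\<^sub>R d) \<bullet> d - gradient f y \<bullet> d - L * (norm d)\<^sup>2 * t) (at t)"
      unfolding \<psi>_def by (auto intro!: derivative_eq_intros DERIV_along_line)
    moreover have "(gradient f (y + t *\<^sub>R d) - gradient f y) \<bullet> d \<le> L * (norm d)\<^sup>2 * t"
    proof -
      have "(gradient f (y + t *\<^sub>R d) - gradient f y) \<bullet> d
          \<le> norm (gradient f (y + t *\<^sub>R d) - gradient f y) * norm d"
        by (rule norm_cauchy_schwarz)
      also have "\<dots> \<le> L * norm (y + t *\<^sub>R d - y) * norm d"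
        using assms unfolding smooth_with_def by (intro mult_right_mono norm_ge_zero) blast
      finally show ?thesis
        using t by (simp add: power2_eq_square mult_ac)
    qed
    ultimately show "\<exists>l. DERIV \<psi> t :> l \<and> l \<le> 0"
      by (auto simp: inner_diff_left)
  qed simp
  then show ?thesis
    by (simp add: \<psi>_def d_def)
qed

section \<open>Existence of minimizers and first-order optimality\<close>
lemma lsc_tendsto_le:
  assumes "lower_semicontinuous h" "X \<longlonglongrightarrow> l" "(\<lambda>n. h (X n)) \<longlonglongrightarrow> m"
  shows "h l \<le> m"
proof (rule ccontr)
  assume "\<not> h l \<le> m"
  then obtain y where y: "m < y" "y < h l"
    using dense by (metis not_le)
  have "h l \<le> Liminf (nhds l) h"
    using assms(1) unfolding lower_semicontinuous_def by blast
  with y have "\<forall>\<^sub>F x in nhds l. y < h x"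
    unfolding le_Liminf_iff by blast
  then have "\<forall>\<^sub>F n in sequentially. y < h (X n)"
    using assms(2) by (rule eventually_compose_filterlim)
  then have "y \<le> m"
    by (intro tendsto_lowerbound[OF assms(3)]) (auto elim: eventually_mono)
  with y show False by simp
qed

text \<open>
  The Weierstrass theorem, by passing to a convergent subsequence of a minimizing sequence. The continuous
  real summand converges along it and can be subtracted, so semicontinuity is applied to \<open>g\<close> itself rather than to the sum.
\<close>
lemma objective_attains_inf:
  fixes g :: "'a::metric_space \<Rightarrow> ereal"
  assumes "continuous_on UNIV \<phi>" "lower_semicontinuous g" "compact S" "S \<noteq> {}"
  obtains x where "x \<in> S" "\<And>z. z \<in> S \<Longrightarrow> objective \<phi> g x \<le> objective \<phi> g z"
proof -
  let ?h = "objective \<phi> g"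
  obtain v where v: "\<And>n. v n \<in> ?h ` S" "v \<longlonglongrightarrow> Inf (?h ` S)"
    using Inf_as_limit[of "?h ` S"] assms(4) by auto
  then have "\<forall>n. \<exists>x. x \<in> S \<and> v n = ?h x" by blast
  then obtain X where X: "\<And>n. X n \<in> S" "\<And>n. v n = ?h (X n)" by metis
  obtain l r where l: "l \<in> S" "strict_mono r" "(X \<circ> r) \<longlonglongrightarrow> l"
    using assms(3) X(1) unfolding compact_def by metis
  have h: "(\<lambda>n. ?h ((X \<circ> r) n)) \<longlonglongrightarrow> Inf (?h ` S)"
    using LIMSEQ_subseq_LIMSEQ[OF v(2) l(2)] X(2) by (simp add: o_def)
  have "isCont \<phi> l"
    using assms(1) by (simp add: continuous_on_eq_continuous_at)
  then have \<phi>: "(\<lambda>n. ereal (- \<phi> ((X \<circ> r) n))) \<longlonglongrightarrow> ereal (- \<phi> l)"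
    by (intro tendsto_intros isCont_tendsto_compose[OF _ l(3)])
  have cancel: "?h x + ereal (- \<phi> x) = g x" for x
    by (cases "g x") (simp_all add: objective_def)
  have "(\<lambda>n. g ((X \<circ> r) n)) \<longlonglongrightarrow> Inf (?h ` S) + ereal (- \<phi> l)"
    using tendsto_add_ereal_general[OF _ h \<phi>] by (simp add: cancel)
  then have "g l \<le> Inf (?h ` S) + ereal (- \<phi> l)"
    by (rule lsc_tendsto_le[OF assms(2) l(3)])
  then have "?h l \<le> Inf (?h ` S)"
    unfolding objective_def by (cases "g l"; cases "Inf (?h ` S)") (simp_all add: objective_def)
  then show ?thesis
    using l(1) by (intro that[of l]) (auto intro: order_trans INF_lower)
qed

text \<open>
  Fermat's rule: at a minimizer of \<open>\<phi> + g\<close> the vector \<open>- D\<close> is a subgradient of \<open>g\<close>. Moving from \<open>x\<close> towards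
  \<open>z\<close> by a fraction \<open>t\<close> changes \<open>g\<close> by at most \<open>t * (g z - g x)\<close> by convexity, so \<open>\<phi>\<close> must increase by at
  least \<open>t * (g x - g z)\<close>; that is a secant bound for \<open>\<phi>\<close>. It is used twice: with \<open>\<phi> = f\<close> it provides an
  affine minorant of \<open>g\<close>, and with \<open>\<phi>\<close> the quadratic of the proximal mapping it characterizes a proximal point.
\<close>
lemma minimizer_subgradient:
  assumes min: "x \<in> minimizers (objective \<phi> g)" and D: "GDERIV \<phi> x :> D"
    and "convex_ereal g" "proper_fun g"
  shows "g x \<noteq> \<infinity>" and "g x + ereal (- (D \<bullet> (z - x))) \<le> g z"
proof -
  obtain w where "g w \<noteq> \<infinity>" using assms(4) by (auto simp: proper_fun_def)
  moreover have "objective \<phi> g x \<le> objective \<phi> g w" for w using min by (auto simp: minimizers_def)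
  ultimately show fin: "g x \<noteq> \<infinity>" by (fastforce simp: objective_def)
  with assms(4) obtain r where r: "g x = ereal r" 
    by (cases "g x") (auto simp: proper_fun_def)
  show "g x + ereal (- (D \<bullet> (z - x))) \<le> g z"
  proof (cases "g z")
    case (real s)
    have "r - s \<le> D \<bullet> (z - x)"
    proof (rule inner_gradient_ge_of_secants[OF D])
      fix t :: real assume t: "0 < t" "t < 1"
      have *: "x + t *\<^sub>R (z - x) = (1 - t) *\<^sub>R x + t *\<^sub>R z"
        by (simp add: algebra_simps)
      have "ereal (\<phi> x + r) = objective \<phi> g x" by (simp add: objective_def r)
      also have "\<dots> \<le> objective \<phi> g (x + t *\<^sub>R (z - x))"
        using min by (simp add: minimizers_def)
      also have "\<dots> \<le> ereal (\<phi> (x + t *\<^sub>R (z - x))) + (ereal (1 - t) * g x + ereal t * g z)"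
        using assms(3) t unfolding objective_def convex_ereal_def *
        by (intro add_left_mono) auto
      finally show "t * (r - s) \<le> \<phi> (x + t *\<^sub>R (z - x)) - \<phi> x"
        by (simp add: r real algebra_simps)
    qed
    then show ?thesis by (simp add: r real)
  qed (use assms(4) in \<open>auto simp: proper_fun_def\<close>)
qed


lemma GDERIV_half_norm_square:
  assumes "\<eta> \<noteq> 0"
  shows "GDERIV (\<lambda>x. (norm (x - u))\<^sup>2 / (2 * \<eta>)) x :> (1 / \<eta>) *\<^sub>R (x - u)"
  using assms unfolding gderiv_def power2_norm_eq_inner
  by (auto intro!: derivative_eq_intros simp: inner_commute divide_simps)

text \<open>
  An affine minorant of \<open>g\<close> that touches it at a point \<open>p\<close> is dominated by the quadratic far away from \<open>u\<close>.
  Hence \<open>p\<close> is at least as good as every point outside a large ball, and a minimizer over that compact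
  ball is a global one.
\<close>
lemma minimizers_quadratic_nonempty:
  fixes g :: "'a::euclidean_space \<Rightarrow> ereal"
  assumes "lower_semicontinuous g" "0 < \<eta>" "\<bar>g p\<bar> \<noteq> \<infinity>"
    and minorant: "\<And>z. g p + ereal (b \<bullet> (z - p)) \<le> g z"
  shows "minimizers (objective (\<lambda>x. (norm (x - u))\<^sup>2 / (2 * \<eta>)) g) \<noteq> {}"
proof -
  define \<phi> where "\<phi> x = (norm (x - u))\<^sup>2 / (2 * \<eta>)" for x
  define \<delta> where "\<delta> = norm (p - u)"
  define R where "R = 2 * (\<eta> * norm b + \<delta>)"
  have \<delta>: "0 \<le> \<delta>" "\<delta> \<le> R" and b: "0 \<le> \<eta> * norm b"
    using assms(2) by (auto simp: \<delta>_def R_def)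
  obtain a where a: "g p = ereal a" using assms(3) by (cases "g p") auto
  have p: "p \<in> cball u R"
    using \<delta> by (simp add: \<delta>_def dist_norm norm_minus_commute)
  have "continuous_on UNIV \<phi>"
    unfolding \<phi>_def divide_inverse by (intro continuous_intros)
  then obtain x where x: "x \<in> cball u R"
    "\<And>z. z \<in> cball u R \<Longrightarrow> objective \<phi> g x \<le> objective \<phi> g z"
    using objective_attains_inf[OF _ assms(1) compact_cball, of \<phi> u R] p by blast
  have far: "objective \<phi> g p \<le> objective \<phi> g z" if "z \<notin> cball u R" for z
  proof -
    define r where "r = norm (z - u)"
    have r: "R \<le> r"
      using that by (simp add: r_def dist_norm norm_minus_commute)
    have "- (b \<bullet> (z - p)) \<le> norm b * norm (z - p)"
      using Cauchy_Schwarz_ineq2[of b "z - p"] by linarith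
    also have "norm (z - p) \<le> r + \<delta>"
      using norm_triangle_ineq4[of "z - u" "p - u"] by (simp add: r_def \<delta>_def)
    finally have *: "- (b \<bullet> (z - p)) \<le> norm b * (r + \<delta>)"
      by (simp add: mult_left_mono)
    have "\<delta>\<^sup>2 + 2 * (\<eta> * norm b) * (r + \<delta>) \<le> r\<^sup>2"
    proof -
      \<comment> \<open>As \<open>r \<ge> R\<close>, the left factor of \<open>r * (r - 2 * (\<eta> * norm b))\<close> is at least \<open>R\<close> and the right one at least \<open>2 * \<delta>\<close>.\<close>
      have "R * (r - 2 * (\<eta> * norm b)) \<le> r * (r - 2 * (\<eta> * norm b))"
        using r \<delta> b by (intro mult_right_mono) (auto simp: R_def)
      moreover have "R * (2 * \<delta>) \<le> R * (r - 2 * (\<eta> * norm b))"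
        using r \<delta> by (intro mult_left_mono) (auto simp: R_def)
      moreover have "\<delta>\<^sup>2 + 2 * (\<eta> * norm b) * \<delta> \<le> R * (2 * \<delta>)"
        using \<delta> b by (simp add: R_def algebra_simps power2_eq_square)
      ultimately show ?thesis
        by (simp add: algebra_simps power2_eq_square)
    qed
    then have "\<delta>\<^sup>2 / (2 * \<eta>) + norm b * (r + \<delta>) \<le> r\<^sup>2 / (2 * \<eta>)"
      using assms(2) divide_right_mono[of _ "r\<^sup>2" "2 * \<eta>"]
      by (fastforce simp: add_divide_distrib)
    with * have "\<phi> p \<le> \<phi> z + b \<bullet> (z - p)"
      by (simp add: \<phi>_def r_def \<delta>_def)
    then have "objective \<phi> g p \<le> ereal (\<phi> z) + (g p + ereal (b \<bullet> (z - p)))"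
      by (simp add: objective_def a)
    also have "\<dots> \<le> objective \<phi> g z"
      unfolding objective_def by (intro add_left_mono minorant)
    finally show ?thesis .
  qed
  have "x \<in> minimizers (objective \<phi> g)"
    using x(2) far p by (auto simp: minimizers_def intro: order_trans)
  then show ?thesis
    by (auto simp: \<phi>_def[abs_def])
qed

text \<open>
  \<open>prox\<close> picks an arbitrary point when its objective has no minimizer, hence the nonemptiness hypothesis. Dividing
  that objective by \<open>\<eta>\<close> leaves the minimizers unchanged and frees \<open>g\<close> of its coefficient.
\<close>
lemma prox_in_minimizers:
  fixes g :: "'a::real_normed_vector \<Rightarrow> ereal"
  assumes "0 < \<eta>" "proper_fun g"
    and nonempty: "minimizers (objective (\<lambda>x. (norm (x - u))\<^sup>2 / (2 * \<eta>)) g) \<noteq> {}"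
  shows "prox \<eta> g u \<in> minimizers (objective (\<lambda>x. (norm (x - u))\<^sup>2 / (2 * \<eta>)) g)"
proof -
  let ?F = "objective (\<lambda>x. (norm (x - u))\<^sup>2 / (2 * \<eta>)) g"
  let ?G = "\<lambda>x. ereal ((norm (x - u))\<^sup>2 / 2) + ereal \<eta> * g x"
  have scale: "?G x = ereal \<eta> * ?F x" for x
    using assms(1,2) by (cases "g x") (auto simp: objective_def proper_fun_def field_simps)
  have iff: "is_arg_min ?G (\<lambda>_. True) x \<longleftrightarrow> x \<in> minimizers ?F" for x
    using assms(1) unfolding is_arg_min_def minimizers_def scale
    by (auto simp: not_less ereal_mult_le_mult_iff)
  show ?thesis
    using nonempty unfolding prox_def arg_min_def iff by (auto intro: someI)
qed


section \<open>The accelerated proximal gradient method\<close>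
locale composite_problem =
  fixes f :: "'a::euclidean_space \<Rightarrow> real" and g :: "'a \<Rightarrow> ereal" and L :: real
  assumes convex_f: "convex_on UNIV f" and smooth_f: "smooth_with L f"
    and proper_g: "proper_fun g" and lsc_g: "lower_semicontinuous g"
    and convex_g: "convex_ereal g"
    and minimizers_nonempty: "minimizers (objective f g) \<noteq> {}"
begin

lemma L_pos: "0 < L"
  using smooth_f by (simp add: smooth_with_def)

lemma gradient_f: "GDERIV f x :> gradient f x"
  using smooth_f by (intro GDERIV_gradient) (simp add: smooth_with_def)

text \<open>
  The excess \<open>F x - F\<^sub>*\<close> as a real number. As \<open>min_value\<close> is finite here, it is faithful exactly where \<open>g\<close> is
  finite; elsewhere the coercion gives \<open>0\<close>, so every statement about it comes with finiteness of \<open>g\<close>.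
\<close>
definition gap :: "'a \<Rightarrow> real" where
  "gap x = real_of_ereal (objective f g x - min_value (objective f g))"

lemma g_finite: "g x \<noteq> \<infinity> \<Longrightarrow> \<bar>g x\<bar> \<noteq> \<infinity>"
  using proper_g by (cases "g x") (auto simp: proper_fun_def)

lemma minimizer_finite:
  assumes "p \<in> minimizers (objective f g)"
  shows "g p \<noteq> \<infinity>"
  using minimizer_subgradient(1)[OF assms gradient_f convex_g proper_g] .

lemma min_value_eq:
  assumes "p \<in> minimizers (objective f g)"
  shows "min_value (objective f g) = objective f g p"
  unfolding min_value_def
  using assms by (intro antisym INF_lower INF_greatest) (auto simp: minimizers_def)

lemma min_value_finite: "\<bar>min_value (objective f g)\<bar> \<noteq> \<infinity>"
proof -
  obtain p where p: "p \<in> minimizers (objective f g)"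
    using minimizers_nonempty by blast
  show ?thesis
    using g_finite[OF minimizer_finite[OF p]] min_value_eq[OF p]
    by (cases "g p") (simp_all add: objective_def)
qed

lemma gap_finite:
  assumes "g x \<noteq> \<infinity>"
  shows "objective f g x - min_value (objective f g) = ereal (gap x)"
    and "gap x = f x + real_of_ereal (g x) - real_of_ereal (min_value (objective f g))"
  using g_finite[OF assms] min_value_finite
  by (cases "g x"; cases "min_value (objective f g)"; simp add: gap_def objective_def)+

lemma gap_le_iff:
  "objective f g x - min_value (objective f g) \<le> ereal e \<longleftrightarrow> g x \<noteq> \<infinity> \<and> gap x \<le> e"
proof (cases "g x = \<infinity>")
  case True
  then show ?thesis
    using min_value_finite by (cases "min_value (objective f g)") (simp_all add: objective_def)
qed (simp add: gap_finite)

lemma gap_nonneg: 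
  assumes "g x \<noteq> \<infinity>"
  shows "0 \<le> gap x"
proof -
  have "min_value (objective f g) \<le> objective f g x"
    unfolding min_value_def by (rule INF_lower) simp
  then have "0 \<le> objective f g x - min_value (objective f g)"
    using min_value_finite by (simp add: ereal_diff_positive)
  then show ?thesis
    by (simp add: gap_finite(1)[OF assms])
qed

lemma gap_toward_minimizer:
  assumes "p \<in> minimizers (objective f g)" "g x \<noteq> \<infinity>" "0 \<le> t" "t \<le> 1"
  shows "g ((1 - t) *\<^sub>R x + t *\<^sub>R p) \<noteq> \<infinity>"
    and "gap ((1 - t) *\<^sub>R x + t *\<^sub>R p) \<le> (1 - t) * gap x"
proof -
  let ?w = "(1 - t) *\<^sub>R x + t *\<^sub>R p"
  have p: "g p \<noteq> \<infinity>" "gap p = 0"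
    using minimizer_finite[OF assms(1)] min_value_finite
    by (auto simp: gap_def min_value_eq[OF assms(1)])
  obtain a b where ab: "g x = ereal a" "g p = ereal b"
    using g_finite[OF assms(2)] g_finite[OF p(1)] by auto
  have "g ?w \<le> ereal (1 - t) * g x + ereal t * g p"
    using convex_g assms(3,4) by (simp add: convex_ereal_def)
  then have w: "g ?w \<le> ereal ((1 - t) * a + t * b)"
    by (simp add: ab)
  then show fin: "g ?w \<noteq> \<infinity>" by auto
  have "f ?w \<le> (1 - t) * f x + t * f p"
    using convex_onD[OF convex_f, of t x p] assms(3,4) by simp
  moreover have "real_of_ereal (g ?w) \<le> (1 - t) * a + t * b"
    using w g_finite[OF fin] by (cases "g ?w") auto
  ultimately have "gap ?w \<le> (1 - t) * gap x + t * gap p"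
    by (simp add: gap_finite(2) fin p(1) assms(2) ab) (simp add: algebra_simps)
  with p(2) show "gap ?w \<le> (1 - t) * gap x" by simp
qed

definition prox_grad :: "'a \<Rightarrow> 'a" where
  "prox_grad y = prox (1 / L) g (y - (1 / L) *\<^sub>R gradient f y)"

text \<open>
  A minimizer \<open>m\<close> of \<open>F\<close> supplies the affine minorant of \<open>g\<close> with slope \<open>- gradient f m\<close>, so the proximal point
  exists; Fermat's rule for its quadratic then gives the subgradient.
\<close>
lemma prox_subgradient:
  fixes u
  defines "p \<equiv> prox (1 / L) g u"
  shows "g p \<noteq> \<infinity>" and "g p + ereal (L * ((u - p) \<bullet> (z - p))) \<le> g z"
proof -
  obtain m where m: "m \<in> minimizers (objective f g)"
    using minimizers_nonempty by blast
  have "g m + ereal ((- gradient f m) \<bullet> (z - m)) \<le> g z" for z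
    using minimizer_subgradient(2)[OF m gradient_f convex_g proper_g, of z] by simp
  then have "p \<in> minimizers (objective (\<lambda>x. (norm (x - u))\<^sup>2 / (2 * (1 / L))) g)"
    using L_pos unfolding p_def
    by (intro prox_in_minimizers proper_g
        minimizers_quadratic_nonempty[OF lsc_g _ g_finite[OF minimizer_finite[OF m]],
          where b = "- gradient f m"]) auto
  note * = minimizer_subgradient[OF this GDERIV_half_norm_square convex_g proper_g]
  show "g p \<noteq> \<infinity>" using L_pos by (intro *(1)) simp
  show "g p + ereal (L * ((u - p) \<bullet> (z - p))) \<le> g z"
    using *(2)[of z] L_pos by (simp add: inner_diff_left algebra_simps)
qed

lemma prox_grad_finite: "g (prox_grad y) \<noteq> \<infinity>"
  unfolding prox_grad_def by (rule prox_subgradient(1))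

text \<open>
  The basic inequality of the proximal gradient step. Three estimates are added: the descent
  inequality bounds \<open>f\<close> at the new point, the tangent inequality bounds \<open>f w\<close> from below, and the proximal
  subgradient bounds \<open>g w\<close> from below. The gradient terms cancel, and what remains is a difference of squared
  distances by polarization of \<open>(y - p) \<bullet> (w - p)\<close>.
\<close>
lemma gap_prox_grad:
  assumes "g w \<noteq> \<infinity>"
  shows "gap (prox_grad y) + L / 2 * (norm (prox_grad y - w))\<^sup>2 \<le> gap w + L / 2 * (norm (y - w))\<^sup>2"
proof -
  define p where "p = prox_grad y"
  let ?u = "y - (1 / L) *\<^sub>R gradient f y"
  have fin: "g p \<noteq> \<infinity>"
    by (simp add: p_def prox_grad_finite)
  obtain a b where ab: "g p = ereal a" "g w = ereal b"
    using g_finite[OF assms] g_finite[OF fin] by auto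
  have "g p + ereal (L * ((?u - p) \<bullet> (w - p))) \<le> g w"
    unfolding p_def prox_grad_def by (rule prox_subgradient(2))
  then have "a + L * ((?u - p) \<bullet> (w - p)) \<le> b"
    by (simp add: ab)
  moreover have "L * ((?u - p) \<bullet> (w - p)) = L * ((y - p) \<bullet> (w - p)) - gradient f y \<bullet> (w - p)"
    using L_pos by (simp add: inner_diff_left right_diff_distrib)
  moreover have "f p \<le> f y + gradient f y \<bullet> (p - y) + L / 2 * (norm (p - y))\<^sup>2"
    using smooth_f by (rule smooth_descent)
  moreover have "f y + gradient f y \<bullet> (w - y) \<le> f w"
    using convex_f gradient_f by (rule convex_on_above_tangent)
  moreover have "gradient f y \<bullet> (w - y) = gradient f y \<bullet> (w - p) + gradient f y \<bullet> (p - y)"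
    by (simp add: inner_diff_right)
  moreover have "L * ((y - p) \<bullet> (w - p))
      = L / 2 * (norm (p - y))\<^sup>2 + L / 2 * (norm (p - w))\<^sup>2 - L / 2 * (norm (y - w))\<^sup>2"
    by (simp add: power2_norm_eq_inner algebra_simps inner_commute)
  ultimately have "f p + a + L / 2 * (norm (p - w))\<^sup>2 \<le> f w + b + L / 2 * (norm (y - w))\<^sup>2"
    by linarith
  then show ?thesis
    by (simp add: p_def[symmetric] gap_finite(2) fin assms ab)
qed

text \<open>
  The basic inequality is applied not at the minimizer \<open>p\<close> but at the point a fraction \<open>1 / s\<close> of the way from
  \<open>x\<close> to \<open>p\<close>: convexity then leaves only the fraction \<open>1 - 1 / s\<close> of the old gap, and after multiplication by \<open>s\<^sup>2\<close>
  the quadratic terms measure the distance to \<open>p\<close> of points extrapolated from \<open>x\<close> by the factor \<open>s\<close>.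
\<close>
lemma accelerated_step:
  fixes y :: 'a
  assumes p: "p \<in> minimizers (objective f g)" and x: "g x \<noteq> \<infinity>" and s: "1 \<le> s"
  defines "x' \<equiv> prox_grad y"
  shows "s\<^sup>2 * gap x' + L / 2 * (norm (x + s *\<^sub>R (x' - x) - p))\<^sup>2
    \<le> (s\<^sup>2 - s) * gap x + L / 2 * (norm (x + s *\<^sub>R (y - x) - p))\<^sup>2"
proof -
  let ?w = "(1 - 1 / s) *\<^sub>R x + (1 / s) *\<^sub>R p"
  have s01: "0 \<le> 1 / s" "1 / s \<le> 1" using s by auto
  note w = gap_toward_minimizer[OF p x s01]
  have "gap x' + L / 2 * (norm (x' - ?w))\<^sup>2 \<le> gap ?w + L / 2 * (norm (y - ?w))\<^sup>2"
    unfolding x'_def using w(1) by (rule gap_prox_grad)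
  also have "\<dots> \<le> (1 - 1 / s) * gap x + L / 2 * (norm (y - ?w))\<^sup>2"
    using w(2) by simp
  finally have "s\<^sup>2 * (gap x' + L / 2 * (norm (x' - ?w))\<^sup>2)
      \<le> s\<^sup>2 * ((1 - 1 / s) * gap x + L / 2 * (norm (y - ?w))\<^sup>2)"
    by (rule mult_left_mono) simp
  moreover have "s\<^sup>2 * (norm (v - ?w))\<^sup>2 = (norm (x + s *\<^sub>R (v - x) - p))\<^sup>2" for v
  proof -
    have "s *\<^sub>R (v - ?w) = x + s *\<^sub>R (v - x) - p"
      using s by (simp add: algebra_simps)
    then show ?thesis
      using s by (metis norm_scaleR power_mult_distrib power2_abs)
  qed
  moreover have "s\<^sup>2 * (1 - 1 / s) = s\<^sup>2 - s"
    using s by (simp add: field_simps power2_eq_square)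
  moreover have "s\<^sup>2 * (a + L / 2 * b) = s\<^sup>2 * a + L / 2 * (s\<^sup>2 * b)" for a b
    by (simp add: algebra_simps)
  ultimately show ?thesis
    by (simp only: mult.assoc[symmetric])
qed

text \<open>
  The energy argument for acceleration. Iteration \<open>\<tau> = n + 1\<close> uses \<open>s = (n + 3) / 2 = (\<tau> + 2) / 2\<close>. Two
  properties of this sequence make the estimates of successive steps telescope:
  \<open>s\<^sup>2 - s\<close> is at most the square \<open>((n + 2) / 2)\<^sup>2\<close> of the preceding parameter, and the momentum factor
  \<open>\<tau> / (\<tau> + 3)\<close> is the quotient of \<open>s - 1\<close> and the next parameter, so that the extrapolated point at the
  end of one step is the one at the start of the next.
\<close>
lemma apg_energy:
  assumes p: "p \<in> minimizers (objective f g)" and z: "g z \<noteq> \<infinity>"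
    and "apg_state L f g z n = (x, y)"
  shows "g x \<noteq> \<infinity>"
    and "((real n + 2) / 2)\<^sup>2 * gap x + L / 2 * (norm (x + ((real n + 3) / 2) *\<^sub>R (y - x) - p))\<^sup>2
      \<le> gap z + L / 2 * (norm (z - p))\<^sup>2"
  using assms(3)
proof (induction n arbitrary: x y)
  case 0
  { case 1 then show ?case using z by simp }
  { case 2 then show ?case by (auto simp: power2_eq_square) }
next
  case (Suc n)
  obtain x0 y0 where st: "apg_state L f g z n = (x0, y0)" by (cases "apg_state L f g z n")
  define s where "s = (real n + 3) / 2"
  have step: "x = prox_grad y0" "y = x + ((real n + 1) / (real n + 4)) *\<^sub>R (x - x0)"
    if "apg_state L f g z (Suc n) = (x, y)" for x y
    using that by (auto simp: st Let_def prox_grad_def add.commute)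
  { case 1 then show ?case using step(1)[OF 1] prox_grad_finite by metis }
  case 2
  note x = step[OF 2]
  have x0: "g x0 \<noteq> \<infinity>" by (rule Suc.IH(1)[OF st])
  \<comment> \<open>The momentum factor is chosen so that the quadratic term carries over unchanged.\<close>
  have "x + ((real (Suc n) + 3) / 2) *\<^sub>R (y - x) = x0 + s *\<^sub>R (x - x0)"
  proof -
    have "y - x = ((real n + 1) / (real n + 4)) *\<^sub>R (x - x0)" by (simp add: x(2))
    moreover have "(real (Suc n) + 3) / 2 * ((real n + 1) / (real n + 4)) = s - 1"
      by (simp add: s_def field_simps)
    ultimately have "((real (Suc n) + 3) / 2) *\<^sub>R (y - x) = (s - 1) *\<^sub>R (x - x0)"
      by (metis scaleR_scaleR)
    then show ?thesis by (simp add: algebra_simps)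
  qed
  moreover have "(real (Suc n) + 2) / 2 = s" by (simp add: s_def)
  moreover have "s\<^sup>2 * gap x + L / 2 * (norm (x0 + s *\<^sub>R (x - x0) - p))\<^sup>2
      \<le> (s\<^sup>2 - s) * gap x0 + L / 2 * (norm (x0 + s *\<^sub>R (y0 - x0) - p))\<^sup>2"
    unfolding x(1) by (rule accelerated_step[OF p x0]) (simp add: s_def)
  moreover have "(s\<^sup>2 - s) * gap x0 \<le> ((real n + 2) / 2)\<^sup>2 * gap x0"
    using gap_nonneg[OF x0]
    by (intro mult_right_mono) (auto simp: s_def power2_eq_square field_simps)
  moreover note Suc.IH(2)[OF st, folded s_def]
  ultimately show ?case by (simp only:) 
qed

text \<open>
  The energy bound holds for every minimizer, so it holds with the distance to the set of minimizers, as an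
  infimum.
\<close>
lemma apg_gap:
  fixes t :: nat
  assumes z: "g z \<noteq> \<infinity>"
  defines "x \<equiv> fst (apg_state L f g z t)"
  shows "g x \<noteq> \<infinity>"
    and "(real t + 2)\<^sup>2 * gap x \<le> 4 * gap z + 2 * L * (infdist z (minimizers (objective f g)))\<^sup>2"
proof -
  let ?S = "minimizers (objective f g)"
  let ?A = "((real t + 2)\<^sup>2 * gap x - 4 * gap z) / (2 * L)"
  obtain y where st: "apg_state L f g z t = (x, y)"
    unfolding x_def by (metis prod.collapse)
  show "g x \<noteq> \<infinity>"
    using apg_energy(1)[OF _ z st] minimizers_nonempty by blast
  have "?A \<le> (dist z p)\<^sup>2" if "p \<in> ?S" for p
  proof -
    have "0 \<le> L / 2 * (norm (x + ((real t + 3) / 2) *\<^sub>R (y - x) - p))\<^sup>2"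
      using L_pos by simp
    with apg_energy(2)[OF that z st]
    have "((real t + 2) / 2)\<^sup>2 * gap x \<le> gap z + L / 2 * (norm (z - p))\<^sup>2"
      by linarith
    then show ?thesis
      using L_pos by (simp add: dist_norm field_simps power2_eq_square)
  qed
  then have "sqrt ?A \<le> dist z p" if "p \<in> ?S" for p
    using that by (intro real_le_lsqrt) auto
  then have "sqrt ?A \<le> infdist z ?S"
    using minimizers_nonempty by (auto simp: infdist_notempty intro!: cINF_greatest)
  then have "?A \<le> (infdist z ?S)\<^sup>2"
    by (rule sqrt_le_D)
  then show "(real t + 2)\<^sup>2 * gap x \<le> 4 * gap z + 2 * L * (infdist z ?S)\<^sup>2"
    using L_pos by (simp add: field_simps)
qed

text \<open>
  The error bound condition replaces the unknown distance by \<open>c * e powr \<theta>\<close>, and the prescribed number of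
  iterations makes \<open>2 * L * (c * e powr \<theta>)\<^sup>2\<close> at most \<open>t\<^sup>2 * e / 2\<close>. Together with the term \<open>4 * e\<close> from the initial gap
  this gives \<open>(t\<^sup>2 + 8) * e / 2\<close>, which \<open>(t + 2)\<^sup>2 * e / 2\<close> dominates as soon as \<open>t \<ge> 1\<close>.
\<close>
lemma apg_halves_gap:
  fixes t :: nat
  assumes heb: "heb_on_sublevel (objective f g) \<xi> \<theta> c" and "0 \<le> \<theta>" "0 < c"
    and e: "0 < e" "e \<le> \<xi>" and z: "g z \<noteq> \<infinity>" "gap z \<le> e"
    and t: "2 * c * sqrt L * e powr (\<theta> - 1/2) \<le> real t"
  defines "x \<equiv> fst (apg_state L f g z t)"
  shows "g x \<noteq> \<infinity>" and "gap x \<le> e / 2"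
proof -
  let ?D = "infdist z (minimizers (objective f g))"
  note x = apg_gap[OF z(1), of t, folded x_def]
  show "g x \<noteq> \<infinity>" by (rule x(1))
  have "0 < 2 * c * sqrt L * e powr (\<theta> - 1/2)"
    using L_pos assms(3) e(1) by simp
  \<comment> \<open>The unrounded count is positive, so its integer upper bound is at least \<open>1\<close>.\<close>
  with t have t1: "1 \<le> real t" by (cases t) auto
  have "z \<in> sublevel_gap (objective f g) \<xi>"
    using z e(2) by (simp add: sublevel_gap_def gap_le_iff)
  with heb have "?D \<le> c * gap z powr \<theta>"
    by (simp add: heb_on_sublevel_def gap_def)
  also have "\<dots> \<le> c * e powr \<theta>"
    using assms(2,3) z(2) gap_nonneg[OF z(1)] by (intro mult_left_mono powr_mono2) auto
  also have "\<dots> = c * e powr (\<theta> - 1/2) * sqrt e"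
    using e(1) by (simp add: powr_diff powr_half_sqrt)
  finally have "2 * sqrt L * ?D \<le> 2 * sqrt L * (c * e powr (\<theta> - 1/2) * sqrt e)"
    using L_pos by (intro mult_left_mono) auto
  also have "\<dots> \<le> real t * sqrt e"
    using mult_right_mono[OF t, of "sqrt e"] e(1) by (simp add: mult_ac)
  finally have "(2 * sqrt L * ?D)\<^sup>2 \<le> (real t * sqrt e)\<^sup>2"
    using L_pos infdist_nonneg[of z] by (intro power_mono) auto
  then have "2 * L * ?D\<^sup>2 \<le> (real t)\<^sup>2 * e / 2"
    using L_pos e(1) by (simp add: power_mult_distrib)
  with x(2) z(2) have "(real t + 2)\<^sup>2 * gap x \<le> ((real t)\<^sup>2 + 8) * (e / 2)"
    by (simp add: algebra_simps)
  also have "\<dots> \<le> (real t + 2)\<^sup>2 * (e / 2)"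
    using t1 e(1) by (intro mult_right_mono) (auto simp: power2_eq_square algebra_simps)
  finally show "gap x \<le> e / 2"
    using t1 by (simp add: mult_le_cancel_left)
qed

lemma rapg_gap:
  assumes heb: "heb_on_sublevel (objective f g) \<epsilon>0 \<theta> c" and "0 \<le> \<theta>" "0 < c" "0 < \<epsilon>0"
    and x0: "g x0 \<noteq> \<infinity>" "gap x0 \<le> \<epsilon>0"
  defines "x \<equiv> rapg L f g (inner_iters \<theta> c L \<epsilon>0) x0"
  shows "g (x k) \<noteq> \<infinity> \<and> gap (x k) \<le> target_gap \<epsilon>0 k"
proof (induction k)
  case 0
  then show ?case using x0 by (simp add: x_def target_gap_def)
next
  case (Suc k)
  have x: "x (Suc k) = fst (apg_state L f g (x k) (inner_iters \<theta> c L \<epsilon>0 (Suc k)))"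
    by (simp add: x_def)
  have "2 * c * sqrt L * target_gap \<epsilon>0 k powr (\<theta> - 1/2) \<le> real (inner_iters \<theta> c L \<epsilon>0 (Suc k))"
    unfolding inner_iters_def unrounded_iters_def by (simp add: real_nat_ceiling_ge)
  moreover have "0 < target_gap \<epsilon>0 k" "target_gap \<epsilon>0 k \<le> \<epsilon>0"
    using assms(4) by (auto simp: target_gap_def divide_le_eq)
  ultimately have "g (x (Suc k)) \<noteq> \<infinity> \<and> gap (x (Suc k)) \<le> target_gap \<epsilon>0 k / 2"
    using apg_halves_gap[OF heb assms(2,3), of "target_gap \<epsilon>0 k" "x k"] Suc unfolding x by blast
  then show ?case by (simp add: target_gap_def mult.commute)
qed

end

section \<open>Number of stages and total number of iterations\<close>

lemma log2_stages:
  assumes "0 < \<epsilon>" "\<epsilon> \<le> \<epsilon>0"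
  shows "real (num_stages \<epsilon>0 \<epsilon>) \<le> log 2 (\<epsilon>0 / \<epsilon>) + 1"
    and "log 2 (\<epsilon>0 / \<epsilon>) \<le> real (num_stages \<epsilon>0 \<epsilon>)"
proof -
  have "0 \<le> log 2 (\<epsilon>0 / \<epsilon>)"
    using assms by (simp add: zero_le_log_cancel_iff)
  then show "real (num_stages \<epsilon>0 \<epsilon>) \<le> log 2 (\<epsilon>0 / \<epsilon>) + 1"
    unfolding num_stages_def by linarith
  show "log 2 (\<epsilon>0 / \<epsilon>) \<le> real (num_stages \<epsilon>0 \<epsilon>)"
    unfolding num_stages_def by linarith
qed

lemma target_gap_num_stages:
  assumes "0 < \<epsilon>" "\<epsilon> \<le> \<epsilon>0"
  shows "target_gap \<epsilon>0 (num_stages \<epsilon>0 \<epsilon>) \<le> \<epsilon>"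
proof -
  have "\<epsilon>0 / \<epsilon> \<le> 2 powr real (num_stages \<epsilon>0 \<epsilon>)"
    using log2_stages(2)[OF assms] assms by (subst (asm) log_le_iff) auto
  then show ?thesis
    using assms by (simp add: target_gap_def powr_realpow field_simps)
qed

text \<open>
  Seen from the last stage the targets grow geometrically backwards, starting from at least \<open>\<epsilon>\<close>. This is the form
  needed for negative exponents, where the last stages are the most expensive ones.
\<close>
lemma target_gap_before_last:
  assumes "0 < \<epsilon>" "\<epsilon> \<le> \<epsilon>0" "j < num_stages \<epsilon>0 \<epsilon>"
  shows "2 ^ (num_stages \<epsilon>0 \<epsilon> - Suc j) * \<epsilon> \<le> target_gap \<epsilon>0 j"
proof -
  let ?K = "num_stages \<epsilon>0 \<epsilon>"
  have K: "real (?K - 1) \<le> log 2 (\<epsilon>0 / \<epsilon>)"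
    using log2_stages(1)[OF assms(1,2)] assms by linarith
  have "2 ^ (?K - 1) \<le> \<epsilon>0 / \<epsilon>"
    using K assms by (subst (asm) le_log_iff) (auto simp: powr_realpow[symmetric] simp del: of_nat_diff)
  moreover have "(2::real) ^ (?K - 1) = 2 ^ (?K - Suc j) * 2 ^ j"
    using assms(3) by (simp flip: power_add)
  ultimately show ?thesis
    using assms by (simp add: target_gap_def field_simps)
qed

lemma geometric_sum_le:
  fixes r :: real
  assumes "0 \<le> r" "r < 1"
  shows "(\<Sum>j<K. r ^ j) \<le> 1 / (1 - r)"
  using assms by (auto simp: sum_gp_strict intro!: divide_right_mono)

lemma power_2_powr: "((2::real) ^ n) powr q = (2 powr q) ^ n"
  by (simp add: powr_powr mult.commute flip: powr_realpow)

lemma sum_target_gap_powr_le_first: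
  assumes "0 < \<epsilon>0" "0 < q"
  shows "(\<Sum>j<K. target_gap \<epsilon>0 j powr q) \<le> \<epsilon>0 powr q / (1 - 2 powr - q)"
proof -
  have "(\<Sum>j<K. target_gap \<epsilon>0 j powr q) = (\<Sum>j<K. \<epsilon>0 powr q * (2 powr - q) ^ j)"
    using assms by (simp add: target_gap_def powr_divide power_2_powr powr_minus divide_simps)
  also have "\<dots> \<le> \<epsilon>0 powr q * (1 / (1 - 2 powr - q))"
    unfolding sum_distrib_left[symmetric]
    using assms(2) powr_less_mono[of "- q" 0 2]
    by (intro mult_left_mono geometric_sum_le) auto
  finally show ?thesis by simp
qed

lemma sum_target_gap_powr_le_last:
  assumes "0 < \<epsilon>" "\<epsilon> \<le> \<epsilon>0" "0 < p"
  shows "(\<Sum>j<num_stages \<epsilon>0 \<epsilon>. target_gap \<epsilon>0 j powr - p) \<le> \<epsilon> powr - p / (1 - 2 powr - p)"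
proof -
  let ?K = "num_stages \<epsilon>0 \<epsilon>"
  have "(\<Sum>j<?K. target_gap \<epsilon>0 j powr - p) \<le> (\<Sum>j<?K. \<epsilon> powr - p * (2 powr - p) ^ (?K - Suc j))"
  proof (rule sum_mono)
    fix j assume "j \<in> {..<?K}"
    then have "target_gap \<epsilon>0 j powr - p \<le> (2 ^ (?K - Suc j) * \<epsilon>) powr - p"
      using assms by (intro powr_mono2' target_gap_before_last) auto
    then show "target_gap \<epsilon>0 j powr - p \<le> \<epsilon> powr - p * (2 powr - p) ^ (?K - Suc j)"
      using assms(1) by (simp add: powr_mult power_2_powr mult.commute)
  qed
  also have "\<dots> = \<epsilon> powr - p * (\<Sum>j<?K. (2 powr - p) ^ j)"
    unfolding sum_distrib_left[symmetric] by (simp add: sum.nat_diff_reindex)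
  also have "\<dots> \<le> \<epsilon> powr - p * (1 / (1 - 2 powr - p))"
    using assms(3) powr_less_mono[of "- p" 0 2]
    by (intro mult_left_mono geometric_sum_le) auto
  finally show ?thesis by simp
qed

lemma sum_unrounded_iters:
  "(\<Sum>k = 1..K. unrounded_iters \<theta> c L \<epsilon>0 k)
    = 2 * (c * sqrt L) * (\<Sum>j<K. target_gap \<epsilon>0 j powr (\<theta> - 1/2))"
proof -
  have "(\<Sum>k = 1..K. unrounded_iters \<theta> c L \<epsilon>0 k) = (\<Sum>j<K. unrounded_iters \<theta> c L \<epsilon>0 (Suc j))"
    by (simp add: sum.atLeast1_atMost_eq)
  then show ?thesis
    by (simp add: unrounded_iters_def sum_distrib_left mult.assoc)
qed

text \<open>
  The stage costs form a geometric progression with ratio \<open>2 powr (1/2 - \<theta>)\<close>. For \<open>\<theta> > 1/2\<close> it decreases and the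
  first stage dominates, for \<open>\<theta> < 1/2\<close> it increases and the last stage dominates, and for \<open>\<theta> = 1/2\<close> all stages cost
  the same, which gives the logarithm. The geometric constant
  \<open>1 / (1 - 2 powr (- \<bar>\<theta> - 1/2\<bar>))\<close> blows up as \<open>\<theta>\<close> approaches \<open>1/2\<close>, but depends only on \<open>\<theta>\<close>.
\<close>
lemma sum_unrounded_iters_le_rate:
  obtains C where "0 < C"
    "\<And>c L \<epsilon>0 \<epsilon>. 0 < c \<Longrightarrow> 0 < L \<Longrightarrow> 0 < \<epsilon> \<Longrightarrow> \<epsilon> \<le> \<epsilon>0 \<Longrightarrow>
      (\<Sum>k = 1..num_stages \<epsilon>0 \<epsilon>. unrounded_iters \<theta> c L \<epsilon>0 k) \<le> C * rapg_rate \<theta> c L \<epsilon>0 \<epsilon>"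
proof -
  note result = that
  define q where "q = \<theta> - 1/2"
  \<comment> \<open>Passing from sums of powers of the targets to iteration counts costs the same factor in all three cases.\<close>
  have bound: thesis
    if C: "0 < C" and S: "\<And>c L \<epsilon>0 \<epsilon>. 0 < c \<Longrightarrow> 0 < L \<Longrightarrow> 0 < \<epsilon> \<Longrightarrow> \<epsilon> \<le> \<epsilon>0 \<Longrightarrow>
      c * sqrt L * (\<Sum>j<num_stages \<epsilon>0 \<epsilon>. target_gap \<epsilon>0 j powr q) \<le> C * rapg_rate \<theta> c L \<epsilon>0 \<epsilon>" for C
  proof (rule result[of "2 * C"])
    show "0 < 2 * C" using C by simp
    fix c L \<epsilon>0 \<epsilon> :: real
    assume "0 < c" "0 < L" "0 < \<epsilon>" "\<epsilon> \<le> \<epsilon>0"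
    from S[OF this] show "(\<Sum>k = 1..num_stages \<epsilon>0 \<epsilon>. unrounded_iters \<theta> c L \<epsilon>0 k)
        \<le> 2 * C * rapg_rate \<theta> c L \<epsilon>0 \<epsilon>"
      unfolding sum_unrounded_iters q_def by simp
  qed
  consider "0 < q" | "q = 0" | "q < 0" by linarith
  then show thesis
  proof cases
    case 1
    show thesis
    proof (rule bound[of "1 / (1 - 2 powr - q)"])
      show "0 < 1 / (1 - 2 powr - q)"
        using 1 powr_less_mono[of "- q" 0 2] by simp
      fix c L \<epsilon>0 \<epsilon> :: real
      assume "0 < c" "0 < L" "0 < \<epsilon>" "\<epsilon> \<le> \<epsilon>0"
      then have "c * sqrt L * (\<Sum>j<num_stages \<epsilon>0 \<epsilon>. target_gap \<epsilon>0 j powr q)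
          \<le> c * sqrt L * (\<epsilon>0 powr q / (1 - 2 powr - q))"
        using 1 by (intro mult_left_mono sum_target_gap_powr_le_first) auto
      then show "c * sqrt L * (\<Sum>j<num_stages \<epsilon>0 \<epsilon>. target_gap \<epsilon>0 j powr q)
          \<le> 1 / (1 - 2 powr - q) * rapg_rate \<theta> c L \<epsilon>0 \<epsilon>"
        using 1 by (simp add: rapg_rate_def q_def)
    qed
  next
    case 2
    then have \<theta>: "\<theta> = 1/2"
      by (simp add: q_def)
    show thesis
    proof (rule bound[of "1 / ln 2 + 1"])
      show "0 < 1 / ln 2 + (1::real)" by (simp add: add_pos_pos)
      fix c L \<epsilon>0 \<epsilon> :: real
      assume *: "0 < c" "0 < L" "0 < \<epsilon>" "\<epsilon> \<le> \<epsilon>0"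
      define R where "R = rapg_rate \<theta> c L \<epsilon>0 \<epsilon>"
      have R: "c * sqrt L \<le> R" "c * sqrt L * ln (\<epsilon>0 / \<epsilon>) \<le> R"
        using * unfolding R_def rapg_rate_def \<theta> by simp_all
      have "c * sqrt L * (\<Sum>j<num_stages \<epsilon>0 \<epsilon>. target_gap \<epsilon>0 j powr q)
          = c * sqrt L * real (num_stages \<epsilon>0 \<epsilon>)"
        using 2 * by (simp add: target_gap_def)
      also have "\<dots> \<le> c * sqrt L * (log 2 (\<epsilon>0 / \<epsilon>) + 1)"
        using * by (intro mult_left_mono log2_stages) auto
      also have "\<dots> = (c * sqrt L * ln (\<epsilon>0 / \<epsilon>)) / ln 2 + c * sqrt L"
        by (simp add: log_def distrib_left)
      also have "\<dots> \<le> R / ln 2 + R"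
        using R by (intro add_mono divide_right_mono) auto
      finally show "c * sqrt L * (\<Sum>j<num_stages \<epsilon>0 \<epsilon>. target_gap \<epsilon>0 j powr q)
          \<le> (1 / ln 2 + 1) * rapg_rate \<theta> c L \<epsilon>0 \<epsilon>"
        by (simp add: R_def distrib_right)
    qed
  next
    case 3
    show thesis
    proof (rule bound[of "1 / (1 - 2 powr q)"])
      show C: "0 < 1 / (1 - 2 powr q)"
        using 3 powr_less_mono[of q 0 2] by simp
      fix c L \<epsilon>0 \<epsilon> :: real
      assume *: "0 < c" "0 < L" "0 < \<epsilon>" "\<epsilon> \<le> \<epsilon>0"
      then have "c * sqrt L * (\<Sum>j<num_stages \<epsilon>0 \<epsilon>. target_gap \<epsilon>0 j powr q)
          \<le> c * sqrt L * (\<epsilon> powr q / (1 - 2 powr q))"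
        using 3 sum_target_gap_powr_le_last[of \<epsilon> \<epsilon>0 "- q"] by (intro mult_left_mono) auto
      also have "\<dots> = 1 / (1 - 2 powr q) * (c * sqrt L / \<epsilon> powr (1/2 - \<theta>))"
        using powr_minus_divide[of \<epsilon> "- q"] by (simp add: q_def)
      also have "\<dots> \<le> 1 / (1 - 2 powr q) * rapg_rate \<theta> c L \<epsilon>0 \<epsilon>"
        using 3 C by (intro mult_left_mono) (auto simp: rapg_rate_def q_def)
      finally show "c * sqrt L * (\<Sum>j<num_stages \<epsilon>0 \<epsilon>. target_gap \<epsilon>0 j powr q)
          \<le> 1 / (1 - 2 powr q) * rapg_rate \<theta> c L \<epsilon>0 \<epsilon>" .
    qed
  qed
qed

lemma unrounded_iters_nonneg: "0 \<le> c \<Longrightarrow> 0 \<le> L \<Longrightarrow> 0 \<le> unrounded_iters \<theta> c L \<epsilon>0 k"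
  by (simp add: unrounded_iters_def)

lemma total_iters_le_sum_plus_stages:
  assumes "0 \<le> c" "0 \<le> L"
  shows "real (total_iters \<theta> c L \<epsilon>0 \<epsilon>)
    \<le> (\<Sum>k = 1..num_stages \<epsilon>0 \<epsilon>. unrounded_iters \<theta> c L \<epsilon>0 k) + real (num_stages \<epsilon>0 \<epsilon>)"
proof -
  have "real (inner_iters \<theta> c L \<epsilon>0 k) \<le> unrounded_iters \<theta> c L \<epsilon>0 k + 1" for k
    using unrounded_iters_nonneg[OF assms, of \<theta> \<epsilon>0 k] unfolding inner_iters_def by linarith
  then have "(\<Sum>k = 1..num_stages \<epsilon>0 \<epsilon>. real (inner_iters \<theta> c L \<epsilon>0 k))
      \<le> (\<Sum>k = 1..num_stages \<epsilon>0 \<epsilon>. unrounded_iters \<theta> c L \<epsilon>0 k + 1)"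
    by (intro sum_mono)
  then show ?thesis
    by (simp add: total_iters_def sum.distrib)
qed

lemma total_iters_le_twice_sum:
  assumes "\<forall>k\<in>{1..num_stages \<epsilon>0 \<epsilon>}. 1 \<le> unrounded_iters \<theta> c L \<epsilon>0 k"
  shows "real (total_iters \<theta> c L \<epsilon>0 \<epsilon>)
    \<le> 2 * (\<Sum>k = 1..num_stages \<epsilon>0 \<epsilon>. unrounded_iters \<theta> c L \<epsilon>0 k)"
proof -
  have "real (inner_iters \<theta> c L \<epsilon>0 k) \<le> 2 * unrounded_iters \<theta> c L \<epsilon>0 k"
    if "k \<in> {1..num_stages \<epsilon>0 \<epsilon>}" for k
    using assms[rule_format, OF that] unfolding inner_iters_def by linarith
  then show ?thesis
    unfolding total_iters_def of_nat_sum sum_distrib_left by (intro sum_mono)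
qed

section \<open>Convergence and complexity of the restarted method\<close>

theorem theorem2:
  fixes \<theta> :: real
  assumes "0 < \<theta>" and "\<theta> \<le> 1"
  shows "\<exists>C>0. \<forall>c L \<epsilon>0 \<epsilon>. 0 < c \<and> 0 < L \<and> 0 < \<epsilon> \<and> \<epsilon> \<le> \<epsilon>0 \<longrightarrow>
    (\<forall>(f :: real ^ 'n \<Rightarrow> real) g x0.
       convex_on UNIV f \<and> smooth_with L f \<and>
       proper_fun g \<and> lower_semicontinuous g \<and> convex_ereal g \<and>
       minimizers (objective f g) \<noteq> {} \<and>
       objective f g x0 - min_value (objective f g) \<le> ereal \<epsilon>0 \<and>
       heb_on_sublevel (objective f g) \<epsilon>0 \<theta> c \<longrightarrow>
         objective f g (rapg L f g (inner_iters \<theta> c L \<epsilon>0) x0 (num_stages \<epsilon>0 \<epsilon>))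
           - min_value (objective f g) \<le> ereal \<epsilon>) \<and>
    ((\<forall>k\<in>{1..num_stages \<epsilon>0 \<epsilon>}. 1 \<le> unrounded_iters \<theta> c L \<epsilon>0 k) \<longrightarrow>
       real (total_iters \<theta> c L \<epsilon>0 \<epsilon>) \<le> C * rapg_rate \<theta> c L \<epsilon>0 \<epsilon>) \<and>
    real (total_iters \<theta> c L \<epsilon>0 \<epsilon>) \<le> C * rapg_rate \<theta> c L \<epsilon>0 \<epsilon> + real (num_stages \<epsilon>0 \<epsilon>)"
proof -
  obtain C where C: "0 < C" and sum_le:
    "\<And>c L \<epsilon>0 \<epsilon>. 0 < c \<Longrightarrow> 0 < L \<Longrightarrow> 0 < \<epsilon> \<Longrightarrow> \<epsilon> \<le> \<epsilon>0 \<Longrightarrow>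
      (\<Sum>k = 1..num_stages \<epsilon>0 \<epsilon>. unrounded_iters \<theta> c L \<epsilon>0 k) \<le> C * rapg_rate \<theta> c L \<epsilon>0 \<epsilon>"
    using sum_unrounded_iters_le_rate[of \<theta>] by blast
  show ?thesis
  proof (intro exI[of _ "2 * C"] conjI allI impI; (elim conjE)?)
    show "0 < 2 * C" using C by simp
  next
    fix c L \<epsilon>0 \<epsilon> :: real and f :: "real ^ 'n \<Rightarrow> real" and g x0
    assume pos: "0 < c" "0 < \<epsilon>" "\<epsilon> \<le> \<epsilon>0"
      and problem: "convex_on UNIV f" "smooth_with L f" "proper_fun g" "lower_semicontinuous g"
        "convex_ereal g" "minimizers (objective f g) \<noteq> {}"
      and x0: "objective f g x0 - min_value (objective f g) \<le> ereal \<epsilon>0"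
      and heb: "heb_on_sublevel (objective f g) \<epsilon>0 \<theta> c"
    interpret composite_problem f g L
      using problem by unfold_locales
    let ?x = "rapg L f g (inner_iters \<theta> c L \<epsilon>0) x0 (num_stages \<epsilon>0 \<epsilon>)"
    have "g ?x \<noteq> \<infinity> \<and> gap ?x \<le> target_gap \<epsilon>0 (num_stages \<epsilon>0 \<epsilon>)"
      using assms(1) pos x0 by (intro rapg_gap[OF heb]) (auto simp: gap_le_iff)
    with target_gap_num_stages[OF pos(2,3)]
    show "objective f g ?x - min_value (objective f g) \<le> ereal \<epsilon>"
      unfolding gap_le_iff by linarith
  next
    fix c L \<epsilon>0 \<epsilon> :: real
    assume pos: "0 < c" "0 < L" "0 < \<epsilon>" "\<epsilon> \<le> \<epsilon>0"
      and "\<forall>k\<in>{1..num_stages \<epsilon>0 \<epsilon>}. 1 \<le> unrounded_iters \<theta> c L \<epsilon>0 k"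
    from total_iters_le_twice_sum[OF this(5)] sum_le[OF pos]
    show "real (total_iters \<theta> c L \<epsilon>0 \<epsilon>) \<le> 2 * C * rapg_rate \<theta> c L \<epsilon>0 \<epsilon>"
      by linarith
  next
    fix c L \<epsilon>0 \<epsilon> :: real
    assume pos: "0 < c" "0 < L" "0 < \<epsilon>" "\<epsilon> \<le> \<epsilon>0"
    have "0 \<le> (\<Sum>k = 1..num_stages \<epsilon>0 \<epsilon>. unrounded_iters \<theta> c L \<epsilon>0 k)"
      using pos by (intro sum_nonneg unrounded_iters_nonneg) auto
    with total_iters_le_sum_plus_stages[of c L \<theta> \<epsilon>0 \<epsilon>] sum_le[OF pos] pos(1,2)
    show "real (total_iters \<theta> c L \<epsilon>0 \<epsilon>)
        \<le> 2 * C * rapg_rate \<theta> c L \<epsilon>0 \<epsilon> + real (num_stages \<epsilon>0 \<epsilon>)"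
      by linarith
  qed
qed

end
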